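(* $\gamma_f^\infty(KG_{5,2})=3$.
   Context: The Kneser graph $KG_{n,k}$ is the graph whose vertices are all $k$-subsets of an $n$-set, two vertices being adjacent if and only if they are disjoint; $KG_{5,2}$ is the Petersen graph. $N(v)$ is the open neighbourhood and $N[v]=N(v)\cup\{v\}$ the closed neighbourhood of $v$. A fractional dominating function of a finite simple graph $G=(V,E)$ is a function $w:V\to[0,\infty)$ with $\sum_{x\in N[v]}w(x)\ge 1$ for all $v\in V$; its total weight is $\sum_{x\in V}w(x)$. Fractional eternal domination. Fix $S$. The defender chooses a fractional dominating function $w_1$ of total weight at most $S$. In each round $i\ge 1$ the attacker, who may choose attacks adaptively, attacks a vertex $v_i\in V$, and the defender chooses amounts $m_{xy,i}\ge 0$ for all $x\in V$, $y\in N(x)$, with $\sum_{y\in N(x)}m_{xy,i}\le w_i(x)$, and sets $w_{i+1}(x)=w_i(x)-\sum_{y\in N(x)}m_{xy,i}+\sum_{y\in N(x)}m_{yx,i}$. It is required that $w_{i+1}$ be a fractional dominating function and $w_{i+1}(v_i)\ge 1$. If the defender can respond in this way to every infinite sequence of attacks, $G$ can be eternally $S$-fractionally dominated. $\gamma_f^\infty(G)$ is the infimum of all $S$ for which $G$ can be eternally $S$-fractionally dominated. *)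

theory Defs
  imports Complex_Main "Graph_Theory.Pair_Digraph"
begin

(* A finite simple graph is a pair_graph: finite vertex set, no loops, and each edge {x, y}
   represented by the two arcs (x, y) and (y, x). *)

definition kneser_graph :: "nat \<Rightarrow> nat \<Rightarrow> nat set pair_pre_digraph" where
  "kneser_graph n k =
    (let V = {A. A \<subseteq> {..<n} \<and> card A = k}
     in \<lparr> pverts = V, parcs = {(A, B). A \<in> V \<and> B \<in> V \<and> A \<inter> B = {}} \<rparr>)"

definition open_nbh :: "'a pair_pre_digraph \<Rightarrow> 'a \<Rightarrow> 'a set" where
  "open_nbh G v = {u. (v, u) \<in> parcs G}"

definition closed_nbh :: "'a pair_pre_digraph \<Rightarrow> 'a \<Rightarrow> 'a set" where
  "closed_nbh G v = insert v (open_nbh G v)"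

definition fractional_dominating :: "'a pair_pre_digraph \<Rightarrow> ('a \<Rightarrow> real) \<Rightarrow> bool" where
  "fractional_dominating G w \<longleftrightarrow>
    (\<forall>x \<in> pverts G. 0 \<le> w x) \<and> (\<forall>v \<in> pverts G. 1 \<le> (\<Sum>x \<in> closed_nbh G v. w x))"

definition total_weight :: "'a pair_pre_digraph \<Rightarrow> ('a \<Rightarrow> real) \<Rightarrow> real" where
  "total_weight G w = (\<Sum>x \<in> pverts G. w x)"

(* m x y is the amount moved from x to its neighbour y. *)
definition legal_move :: "'a pair_pre_digraph \<Rightarrow> ('a \<Rightarrow> real) \<Rightarrow> ('a \<Rightarrow> 'a \<Rightarrow> real) \<Rightarrow> bool" where
  "legal_move G w m \<longleftrightarrow>
    (\<forall>x \<in> pverts G. (\<forall>y \<in> open_nbh G x. 0 \<le> m x y) \<and> (\<Sum>y \<in> open_nbh G x. m x y) \<le> w x)"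

definition move_result :: "'a pair_pre_digraph \<Rightarrow> ('a \<Rightarrow> real) \<Rightarrow> ('a \<Rightarrow> 'a \<Rightarrow> real) \<Rightarrow> 'a \<Rightarrow> real" where
  "move_result G w m x =
    w x - (\<Sum>y \<in> open_nbh G x. m x y) + (\<Sum>y \<in> open_nbh G x. m y x)"

(* A defence strategy assigns the defender's move to the nonempty list of attacks made so far,
   the current attack being the last one. Rounds are numbered from 0: a i is the attack of
   round i, and play_weights G w0 \<sigma> a i is the weight function before that attack. *)
type_synonym 'a defence = "'a list \<Rightarrow> 'a \<Rightarrow> 'a \<Rightarrow> real"

definition response :: "'a defence \<Rightarrow> (nat \<Rightarrow> 'a) \<Rightarrow> nat \<Rightarrow> 'a \<Rightarrow> 'a \<Rightarrow> real" where
  "response \<sigma> a i = \<sigma> (map a [0..<Suc i])"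

primrec play_weights ::
  "'a pair_pre_digraph \<Rightarrow> ('a \<Rightarrow> real) \<Rightarrow> 'a defence \<Rightarrow> (nat \<Rightarrow> 'a) \<Rightarrow> nat \<Rightarrow> 'a \<Rightarrow> real" where
  "play_weights G w0 \<sigma> a 0 = w0"
| "play_weights G w0 \<sigma> a (Suc i) =
    move_result G (play_weights G w0 \<sigma> a i) (response \<sigma> a i)"

(* The initial weights and the strategy are fixed before the attack sequence, and the response
   in round i depends only on the attacks up to round i, so the defender never sees future
   attacks. As the defender's moves are determined by the attacks, an adaptive attacker
   can produce exactly the plays arising from fixed sequences a. *)
definition eternally_fractionally_dominated :: "'a pair_pre_digraph \<Rightarrow> real \<Rightarrow> bool" where
  "eternally_fractionally_dominated G S \<longleftrightarrow>
    (\<exists>w0 \<sigma>. fractional_dominating G w0 \<and> total_weight G w0 \<le> S \<and>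
      (\<forall>a. range a \<subseteq> pverts G \<longrightarrow>
        (\<forall>i. legal_move G (play_weights G w0 \<sigma> a i) (response \<sigma> a i) \<and>
             fractional_dominating G (play_weights G w0 \<sigma> a (Suc i)) \<and>
             1 \<le> play_weights G w0 \<sigma> a (Suc i) (a i))))"

definition fractional_eternal_domination_number :: "'a pair_pre_digraph \<Rightarrow> real" where
  "fractional_eternal_domination_number G = Inf {S. eternally_fractionally_dominated G S}"

(* For k = 0 the only vertex is the empty set, which is disjoint from itself. *)
lemma pair_graph_kneser_graph:
  assumes "0 < k"
  shows "pair_graph (kneser_graph n k)"
proof -
  have fin: "finite {A. A \<subseteq> {..<n} \<and> card A = k}"
    by (rule finite_subset[of _ "Pow {..<n}"]) auto
  have verts: "finite (pverts (kneser_graph n k))"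
    using fin by (simp add: kneser_graph_def Let_def)
  have arcs: "parcs (kneser_graph n k) \<subseteq> pverts (kneser_graph n k) \<times> pverts (kneser_graph n k)"
    by (auto simp: kneser_graph_def Let_def)
  have arcs_fin: "finite (parcs (kneser_graph n k))"
    by (rule finite_subset[OF arcs]) (intro finite_cartesian_product verts)
  have arcs_sym: "sym (parcs (kneser_graph n k))"
    by (rule symI) (simp add: kneser_graph_def Let_def Int_commute)
  have loopfree: "fst e \<noteq> snd e" if "e \<in> parcs (kneser_graph n k)" for e
    using that assms by (cases e) (auto simp: kneser_graph_def Let_def)
  interpret pair_wf_digraph "kneser_graph n k"
    using arcs by unfold_locales auto
  show ?thesis
    by unfold_locales (use verts arcs_fin arcs_sym loopfree in \<open>simp_all add: symmetric_def\<close>)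
qed

(* The infimum over the reals is taken over a nonempty set that is bounded below. *)
lemma eternally_fractionally_dominated_card:
  assumes "pair_graph G"
  shows "eternally_fractionally_dominated G (real (card (pverts G)))"
proof -
  interpret pair_graph G by fact
  have finN: "finite (open_nbh G v)" for v
    using pair_finite_verts in_arcsD2
    by (auto simp: open_nbh_def intro: finite_subset[of _ "pverts G"])
  have dom: "fractional_dominating G (\<lambda>_. 1)"
    unfolding fractional_dominating_def closed_nbh_def using finN by (auto simp: Suc_le_eq card_gt_0_iff)
  have play: "play_weights G (\<lambda>_. 1) (\<lambda>_ _ _. 0) a i = (\<lambda>_. 1)" for a i
    by (induction i) (simp_all add: move_result_def response_def fun_eq_iff)
  show ?thesis
    unfolding eternally_fractionally_dominated_def
    by (rule exI[of _ "\<lambda>_. 1"], rule exI[of _ "\<lambda>_ _ _. 0"])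
       (simp only: play dom, simp add: total_weight_def legal_move_def response_def)
qed

lemma bdd_below_eternally_fractionally_dominated:
  "bdd_below {S. eternally_fractionally_dominated G S}"
proof (rule bdd_belowI[of _ 0])
  fix S assume "S \<in> {S. eternally_fractionally_dominated G S}"
  then obtain w where "fractional_dominating G w" "total_weight G w \<le> S"
    by (auto simp: eternally_fractionally_dominated_def)
  then show "0 \<le> S"
    unfolding fractional_dominating_def total_weight_def
    by (meson order_trans sum_nonneg)
qed

end

theory Submission
  imports Defs
begin

text \<open>
  The Petersen graph \<open>KG\<^sub>5\<^sub>,\<^sub>2\<close> is the Moore graph of diameter 2 and degree 3: adjacent vertices
  have no common neighbour and distinct non-adjacent vertices have exactly one. The value 3 is its
  degree; the argument below shows that every Moore graph of diameter 2 and degree \<open>k \<ge> 1\<close> has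
  fractional eternal domination number \<open>k\<close>.

  Both bounds come from one weight function. For a vertex \<open>v\<close> let \<open>guard v\<close> be 1 at \<open>v\<close>, 0 on the
  neighbours of \<open>v\<close> and \<open>1/k\<close> at all vertices at distance 2. Its total weight is \<open>k\<close>, and its sum
  over a closed neighbourhood \<open>N[x]\<close> is exactly 1 unless \<open>x\<close> is a neighbour of \<open>v\<close>, in which case
  it lies between 1 and 2.

  Upper bound: the defender keeps the weights equal to \<open>guard v\<close>, where \<open>v\<close> is the vertex attacked
  last. When \<open>u \<noteq> v\<close> is attacked next, \<open>guard v\<close> can be turned into \<open>guard u\<close> in a single round:
  \<open>v\<close> sends \<open>1/k\<close> to each of its neighbours outside \<open>N(u)\<close>, while \<open>u\<close> receives \<open>1/k\<close> from each of
  its neighbours outside \<open>N(v)\<close> (lemmas \<open>legal_move_shift\<close> and \<open>move_result_shift\<close>).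

  Lower bound: if \<open>w\<close> is fractionally dominating and \<open>w v \<ge> 1\<close>, use \<open>guard v\<close> as a system of
  multipliers for the domination inequalities. Adding them up shows that the total weight of \<open>w\<close>
  is at least \<open>w v + k - 1\<close> (lemma \<open>total_weight_ge_degree\<close>). The defender is in this situation
  after the first round, and moves do not change the total weight.
\<close>

section \<open>Moves preserve the total weight\<close>

context pair_graph
begin

lemma open_nbh_subset: "open_nbh G x \<subseteq> pverts G"
  using in_arcsD2 by (auto simp: open_nbh_def)

lemma finite_open_nbh [simp]: "finite (open_nbh G x)"
  using finite_subset[OF open_nbh_subset] pair_finite_verts by blast

lemma not_in_open_nbh_self [simp]: "x \<notin> open_nbh G x"
  using no_loops' by (auto simp: open_nbh_def)

lemma open_nbh_commute: "y \<in> open_nbh G x \<longleftrightarrow> x \<in> open_nbh G y"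
  using arcs_symmetric by (auto simp: open_nbh_def)

lemma sum_open_nbh_swap:
  fixes f :: "'a \<Rightarrow> 'a \<Rightarrow> real"
  shows "(\<Sum>x\<in>pverts G. \<Sum>y\<in>open_nbh G x. f x y) = (\<Sum>x\<in>pverts G. \<Sum>y\<in>open_nbh G x. f y x)"
proof -
  have nbh: "{y \<in> pverts G. y \<in> open_nbh G x} = open_nbh G x"
            "{y \<in> pverts G. x \<in> open_nbh G y} = open_nbh G x" for x
    using open_nbh_subset open_nbh_commute by blast+
  show ?thesis
    using sum.swap_restrict[of "pverts G" "pverts G" f "\<lambda>x y. y \<in> open_nbh G x"]
    by (simp add: nbh)
qed

lemma sum_closed_nbh: "(\<Sum>y\<in>closed_nbh G x. f y) = f x + (\<Sum>y\<in>open_nbh G x. f y :: real)"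
  by (simp add: closed_nbh_def)

lemma total_weight_move_result: "total_weight G (move_result G w m) = total_weight G w"
  using sum_open_nbh_swap[of m]
  by (simp add: total_weight_def move_result_def sum.distrib sum_subtractf)

end

section \<open>The guarding weights of a Moore graph of diameter 2\<close>

text \<open>
  These are the strongly regular graphs with parameters \<open>(k\<^sup>2 + 1, k, 0, 1)\<close>: the pentagon, the
  Petersen graph and the Hoffman-Singleton graph are examples. Degree 0 is excluded because the
  one-vertex graph has fractional eternal domination number 1.
\<close>

locale moore_graph_diam2 = pair_graph G for G :: "'a pair_pre_digraph" +
  fixes k :: nat
  assumes degree_pos: "1 \<le> k"
    and card_verts: "card (pverts G) = k\<^sup>2 + 1"
    and regular: "v \<in> pverts G \<Longrightarrow> card (open_nbh G v) = k"
    and triangle_free: "u \<in> open_nbh G v \<Longrightarrow> open_nbh G u \<inter> open_nbh G v = {}"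
    and common_nbh: "\<lbrakk>u \<in> pverts G; v \<in> pverts G; u \<noteq> v; u \<notin> open_nbh G v\<rbrakk>
      \<Longrightarrow> card (open_nbh G u \<inter> open_nbh G v) = 1"
begin

text \<open>
  Outside the vertex set the value is \<open>1/k\<close> for every \<open>v\<close>; this makes \<open>move_result_shift\<close> below an
  equation between functions, as the recursion for \<open>play_weights\<close> requires.
\<close>

definition guard :: "'a \<Rightarrow> 'a \<Rightarrow> real" where
  "guard v x = (if x = v then 1 else if x \<in> open_nbh G v then 0 else 1 / k)"

lemma guard_nonneg: "0 \<le> guard v x"
  by (simp add: guard_def)

lemma total_weight_guard:
  assumes "v \<in> pverts G"
  shows "total_weight G (guard v) = k"
proof -
  let ?far = "pverts G - insert v (open_nbh G v)"
  have sub: "insert v (open_nbh G v) \<subseteq> pverts G"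
    using assms open_nbh_subset by blast
  have "card ?far = k\<^sup>2 + 1 - (k + 1)"
    using sub assms by (subst card_Diff_subset) (simp_all add: card_verts regular)
  then have far: "real (card ?far) = real k * (real k - 1)"
    using degree_pos by (simp add: power2_eq_square of_nat_diff algebra_simps)
  have "total_weight G (guard v) = (\<Sum>x\<in>insert v (open_nbh G v). guard v x) + (\<Sum>x\<in>?far. guard v x)"
    using sub sum.subset_diff[OF sub pair_finite_verts, of "guard v"]
    by (simp add: total_weight_def)
  also have "(\<Sum>x\<in>insert v (open_nbh G v). guard v x) = 1"
    by (auto simp: guard_def intro!: sum.neutral)
  also have "(\<Sum>x\<in>?far. guard v x) = card ?far * (1 / k)"
    by (simp add: guard_def)
  finally show ?thesis
    using far degree_pos by (simp add: field_simps)
qed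

text \<open>
  A vertex \<open>x\<close> at distance 2 from \<open>v\<close> has exactly one neighbour of weight 0, namely the common
  neighbour with \<open>v\<close>; so \<open>x\<close> and its other \<open>k - 1\<close> neighbours contribute \<open>k \<sqdot> 1/k\<close>. A neighbour
  of \<open>v\<close> sees \<open>v\<close> itself and, as there are no triangles, \<open>k - 1\<close> vertices of weight \<open>1/k\<close>.
\<close>

lemma sum_closed_nbh_guard:
  assumes "v \<in> pverts G" "x \<in> pverts G"
  shows "(\<Sum>y\<in>closed_nbh G x. guard v y) = 1 + (if x \<in> open_nbh G v then (k - 1) / k else 0)"
proof -
  have k0: "real k > 0" using degree_pos by simp
  consider "x = v" | "x \<in> open_nbh G v" | "x \<noteq> v" "x \<notin> open_nbh G v" by blast
  then show ?thesis
  proof cases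
    case 1
    then show ?thesis
      by (auto simp: sum_closed_nbh guard_def intro!: sum.neutral)
  next
    case 2
    have "v \<in> open_nbh G x" "x \<noteq> v"
      using 2 open_nbh_commute by auto
    moreover have "(\<Sum>y\<in>open_nbh G x - {v}. guard v y) = (\<Sum>y\<in>open_nbh G x - {v}. 1 / k)"
      using triangle_free[OF 2] by (intro sum.cong) (auto simp: guard_def)
    moreover have "card (open_nbh G x - {v}) = k - 1"
      using regular[OF assms(2)] \<open>v \<in> open_nbh G x\<close> by simp
    ultimately show ?thesis
      using 2 degree_pos sum.remove[of "open_nbh G x" v "guard v"]
      by (simp add: sum_closed_nbh guard_def of_nat_diff)
  next
    case 3
    have "v \<notin> open_nbh G x"
      using 3 open_nbh_commute by blast
    then have "(\<Sum>y\<in>open_nbh G x. guard v y) = (\<Sum>y\<in>open_nbh G x - open_nbh G v. 1 / k)"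
      by (intro sum.mono_neutral_cong_right) (auto simp: guard_def)
    moreover have "card (open_nbh G x - open_nbh G v) = k - 1"
      using regular[OF assms(2)] common_nbh[OF assms(2,1) 3] by (simp add: card_Diff_subset_Int)
    ultimately show ?thesis
      using 3 k0 degree_pos by (simp add: sum_closed_nbh guard_def of_nat_diff field_simps)
  qed
qed

lemma fractional_dominating_guard:
  "v \<in> pverts G \<Longrightarrow> fractional_dominating G (guard v)"
  by (simp add: fractional_dominating_def guard_nonneg sum_closed_nbh_guard)

section \<open>Upper bound: the guard follows the attacks\<close>

text \<open>
  The move has to turn \<open>guard v\<close> into \<open>guard u\<close>. Only arcs leaving \<open>v\<close> or entering \<open>u\<close> carry
  weight, and such an arc is blocked if it ends in \<open>N(u)\<close>, where nothing is wanted, or starts in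
  \<open>N(v)\<close>, where nothing is available.
\<close>

definition shift :: "'a \<Rightarrow> 'a \<Rightarrow> 'a \<Rightarrow> 'a \<Rightarrow> real" where
  "shift v u x y =
    (if v \<noteq> u \<and> (x = v \<and> y \<notin> open_nbh G u \<or> y = u \<and> x \<notin> open_nbh G v) then 1 / k else 0)"

lemma shift_self [simp]: "shift v v = (\<lambda>_ _. 0)"
  by (simp add: shift_def fun_eq_iff)

lemma sum_shift_out:
  assumes "u \<in> pverts G" "v \<in> pverts G" "u \<noteq> v"
  shows "(\<Sum>y\<in>open_nbh G x. shift v u x y) =
    (if x = v then 1 - guard u v
     else if x \<in> open_nbh G u \<and> x \<notin> open_nbh G v then 1 / k else 0)"
proof (cases "x = v")
  case True
  have "(\<Sum>y\<in>open_nbh G v. shift v u v y) = (\<Sum>y\<in>open_nbh G v - open_nbh G u. 1 / k)"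
    using assms(3) by (intro sum.mono_neutral_cong_right) (auto simp: shift_def)
  also have "\<dots> = (real k - card (open_nbh G v \<inter> open_nbh G u)) / k"
    using regular[OF assms(2)] card_mono[of "open_nbh G v" "open_nbh G v \<inter> open_nbh G u"]
    by (simp add: card_Diff_subset_Int of_nat_diff)
  also have "\<dots> = 1 - guard u v"
    using assms(3) degree_pos triangle_free[of v u] common_nbh[of v u] assms(1,2)
    by (auto simp: guard_def field_simps)
  finally show ?thesis using True by simp
next
  case False
  then have "shift v u x y = (if y = u then if x \<notin> open_nbh G v then 1 / k else 0 else 0)" for y
    using assms(3) by (auto simp: shift_def)
  then show ?thesis
    using False open_nbh_commute[of u x] by (simp add: sum.delta)
qed

text \<open>
  Reversing all arcs exchanges the roles of \<open>v\<close> and \<open>u\<close>, which reduces the inflow to the outflow.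
\<close>

lemma sum_shift_in:
  assumes "u \<in> pverts G" "v \<in> pverts G" "u \<noteq> v"
  shows "(\<Sum>y\<in>open_nbh G x. shift v u y x) =
    (if x = u then 1 - guard v u
     else if x \<in> open_nbh G v \<and> x \<notin> open_nbh G u then 1 / k else 0)"
proof -
  have "shift v u y x = shift u v x y" for y
    by (auto simp: shift_def)
  then show ?thesis
    using sum_shift_out[OF assms(2,1)] assms(3) by auto
qed

lemma legal_move_shift:
  assumes "u \<in> pverts G" "v \<in> pverts G"
  shows "legal_move G (guard v) (shift v u)"
proof (cases "u = v")
  case True
  then show ?thesis by (simp add: legal_move_def guard_nonneg)
next
  case False
  have "0 \<le> shift v u x y" for x y
    by (simp add: shift_def)
  then show ?thesis
    using sum_shift_out[OF assms False] guard_nonneg[of u v]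
    by (auto simp: legal_move_def guard_def)
qed

lemma move_result_shift:
  assumes "u \<in> pverts G" "v \<in> pverts G"
  shows "move_result G (guard v) (shift v u) = guard u"
proof (cases "u = v")
  case True
  then show ?thesis by (simp add: move_result_def fun_eq_iff)
next
  case False
  then show ?thesis
    using sum_shift_out[OF assms False] sum_shift_in[OF assms False]
    by (auto simp: move_result_def fun_eq_iff guard_def)
qed

lemma eternally_fractionally_dominated_degree:
  "eternally_fractionally_dominated G k"
proof -
  have "pverts G \<noteq> {}" using card_verts by auto
  then obtain v where v: "v \<in> pverts G" by blast
  \<comment> \<open>Before the first attack, the guard stands at an arbitrary vertex \<open>v\<close>, as if \<open>v\<close> had been attacked.\<close>
  define \<sigma> where "\<sigma> h = shift (last (v # butlast h)) (last h)" for h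
  define prev where "prev a i = (case i of 0 \<Rightarrow> v | Suc j \<Rightarrow> a j)" for a and i :: nat
  have \<sigma>: "response \<sigma> a i = shift (prev a i) (a i)" for a i
    by (cases i) (simp_all add: response_def \<sigma>_def prev_def butlast_append)
  have prev: "prev a i \<in> pverts G" "a i \<in> pverts G" if "range a \<subseteq> pverts G" for a i
    using that v by (auto simp: prev_def split: nat.split)
  have play: "play_weights G (guard v) \<sigma> a i = guard (prev a i)" if "range a \<subseteq> pverts G" for a i
  proof (induction i)
    case 0
    show ?case by (simp add: prev_def)
  next
    case (Suc i)
    then show ?case
      using move_result_shift[OF prev(2)[OF that] prev(1)[OF that]] by (simp add: \<sigma>) (simp add: prev_def)
  qed
  show ?thesis
    unfolding eternally_fractionally_dominated_def
  proof (intro exI[of _ "guard v"] exI[of _ \<sigma>] conjI allI impI)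
    show "fractional_dominating G (guard v)" "total_weight G (guard v) \<le> k"
      using v by (simp_all add: fractional_dominating_guard total_weight_guard)
    fix a :: "nat \<Rightarrow> 'a" and i
    assume a: "range a \<subseteq> pverts G"
    show "legal_move G (play_weights G (guard v) \<sigma> a i) (response \<sigma> a i)"
      using legal_move_shift prev[OF a] by (simp add: play[OF a] \<sigma>)
    show "fractional_dominating G (play_weights G (guard v) \<sigma> a (Suc i))"
      using fractional_dominating_guard prev[OF a] by (simp only: play[OF a])
    show "1 \<le> play_weights G (guard v) \<sigma> a (Suc i) (a i)"
      by (simp only: play[OF a]) (simp add: prev_def guard_def)
  qed
qed

section \<open>Lower bound: the guarding weights as multipliers\<close>

text \<open>
  Double counting gives \<open>\<Sum>x. guard v x * w(N[x]) = \<Sum>x. w x * guard v (N[x])\<close>. On the left, the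
  domination inequalities together with the exact value of \<open>w(N[v])\<close> give at least
  \<open>k - 1 + w v + w(N(v))\<close>; on the right, the sums of \<open>guard v\<close> over closed neighbourhoods give at
  most \<open>\<Sum>x. w x\<close> plus \<open>w(N(v))\<close>. The terms \<open>w(N(v))\<close> cancel.
\<close>

lemma total_weight_ge_degree:
  assumes dom: "fractional_dominating G w" and v: "v \<in> pverts G" and wv: "1 \<le> w v"
  shows "k \<le> total_weight G w"
proof -
  have w0: "0 \<le> w x" if "x \<in> pverts G" for x
    using dom that by (simp add: fractional_dominating_def)
  have w1: "1 \<le> (\<Sum>y\<in>closed_nbh G x. w y)" if "x \<in> pverts G" for x
    using dom that by (simp add: fractional_dominating_def)
  let ?W = "\<lambda>x. \<Sum>y\<in>closed_nbh G x. w y"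
  let ?C = "\<lambda>x. \<Sum>y\<in>closed_nbh G x. guard v y"
  have double_count: "(\<Sum>x\<in>pverts G. guard v x * ?W x) = (\<Sum>x\<in>pverts G. w x * ?C x)"
    using sum_open_nbh_swap[of "\<lambda>x y. guard v x * w y"]
    by (simp add: sum_closed_nbh distrib_left sum.distrib sum_distrib_left)
      (simp add: mult.commute)
  have "k + (?W v - 1) = (\<Sum>x\<in>pverts G. guard v x + (if x = v then ?W x - 1 else 0))"
    using total_weight_guard[OF v] v pair_finite_verts
    by (simp add: sum.distrib total_weight_def)
  also have "\<dots> \<le> (\<Sum>x\<in>pverts G. guard v x * ?W x)"
  proof (intro sum_mono)
    fix x assume "x \<in> pverts G"
    then show "guard v x + (if x = v then ?W x - 1 else 0) \<le> guard v x * ?W x"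
      using mult_left_mono[OF w1 guard_nonneg, of x v x] by (auto simp: guard_def)
  qed
  also have "\<dots> = (\<Sum>x\<in>pverts G. w x * ?C x)"
    by (rule double_count)
  also have "\<dots> \<le> (\<Sum>x\<in>pverts G. w x + (if x \<in> open_nbh G v then w x else 0))"
  proof (intro sum_mono)
    fix x assume x: "x \<in> pverts G"
    have "?C x \<le> 1 + (if x \<in> open_nbh G v then 1 else 0)"
      using sum_closed_nbh_guard[OF v x] degree_pos by (simp add: divide_le_eq_1)
    then have "w x * ?C x \<le> w x * (1 + (if x \<in> open_nbh G v then 1 else 0))"
      using w0[OF x] by (rule mult_left_mono)
    then show "w x * ?C x \<le> w x + (if x \<in> open_nbh G v then w x else 0)"
      by (simp split: if_splits)
  qed
  also have "\<dots> = total_weight G w + (\<Sum>x\<in>open_nbh G v. w x)"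
    using open_nbh_subset pair_finite_verts
    by (simp add: sum.distrib total_weight_def sum.inter_restrict[symmetric] Int_absorb1)
  finally show ?thesis
    using wv by (simp add: sum_closed_nbh)
qed

lemma degree_le_of_eternally_fractionally_dominated:
  fixes S :: real
  assumes "eternally_fractionally_dominated G S"
  shows "k \<le> S"
proof -
  obtain w \<sigma> where w: "total_weight G w \<le> S"
    and defence: "\<And>a i. range a \<subseteq> pverts G \<Longrightarrow>
      fractional_dominating G (play_weights G w \<sigma> a (Suc i)) \<and>
      1 \<le> play_weights G w \<sigma> a (Suc i) (a i)"
    using assms unfolding eternally_fractionally_dominated_def by blast
  have "pverts G \<noteq> {}" using card_verts by auto
  then obtain v where v: "v \<in> pverts G" by blast
  have "k \<le> total_weight G (play_weights G w \<sigma> (\<lambda>_. v) (Suc 0))"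
    using defence[of "\<lambda>_. v" 0] v by (intro total_weight_ge_degree[OF _ v]) auto
  then show ?thesis
    using w by (simp add: total_weight_move_result)
qed

theorem fractional_eternal_domination_number_eq_degree:
  "fractional_eternal_domination_number G = k"
  unfolding fractional_eternal_domination_number_def
  using eternally_fractionally_dominated_degree degree_le_of_eternally_fractionally_dominated
  by (intro cInf_eq_minimum) auto

end

section \<open>The Petersen graph\<close>

lemma open_nbh_kneser_graph:
  assumes "A \<in> pverts (kneser_graph n k)"
  shows "open_nbh (kneser_graph n k) A = {B. B \<subseteq> {..<n} - A \<and> card B = k}"
  using assms by (auto simp: open_nbh_def kneser_graph_def)

text \<open>
  Two vertices \<open>A\<close>, \<open>B\<close> have as many common neighbours as the complement of \<open>A \<union> B\<close> has 2-subsets.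
  For \<open>A = B\<close>, \<open>\<bar>A \<inter> B\<bar> = 1\<close> and \<open>A \<inter> B = {}\<close> the complement has 3, 2 and 1 elements.
\<close>

lemma card_common_nbh_petersen:
  assumes "A \<in> pverts (kneser_graph 5 2)" "B \<in> pverts (kneser_graph 5 2)"
  shows "card (open_nbh (kneser_graph 5 2) A \<inter> open_nbh (kneser_graph 5 2) B) =
    (1 + card (A \<inter> B)) choose 2"
proof -
  have AB: "A \<subseteq> {..<5}" "B \<subseteq> {..<5}" "card A = 2" "card B = 2"
    using assms by (auto simp: kneser_graph_def)
  have fin: "finite A" "finite B"
    using AB finite_subset by blast+
  have "card ({..<5} - (A \<union> B)) = 5 - card (A \<union> B)"
    using AB fin by (subst card_Diff_subset) auto
  also have "\<dots> = 1 + card (A \<inter> B)"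
    using card_Un_Int[OF fin] AB card_mono[of "{..<5}" "A \<union> B"]
      card_mono[OF fin(1), of "A \<inter> B"] by simp
  finally have compl: "card ({..<5} - (A \<union> B)) = 1 + card (A \<inter> B)" .
  have "open_nbh (kneser_graph 5 2) A \<inter> open_nbh (kneser_graph 5 2) B =
      {C. C \<subseteq> {..<5} - (A \<union> B) \<and> card C = 2}"
    using assms by (auto simp: open_nbh_kneser_graph)
  then show ?thesis
    using n_subsets[of "{..<5} - (A \<union> B)" 2] compl by simp
qed

lemma moore_graph_petersen: "moore_graph_diam2 (kneser_graph 5 2) 3"
proof -
  let ?G = "kneser_graph 5 2"
  interpret pair_graph ?G
    by (rule pair_graph_kneser_graph) simp
  have verts: "A \<in> pverts ?G \<longleftrightarrow> A \<subseteq> {..<5} \<and> card A = 2" for A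
    by (simp add: kneser_graph_def)
  show ?thesis
  proof
    show "1 \<le> (3 :: nat)" by simp
    show "card (pverts ?G) = 3\<^sup>2 + 1"
      using n_subsets[of "{..<5::nat}" 2] by (simp add: kneser_graph_def choose_two)
    show "card (open_nbh ?G A) = 3" if "A \<in> pverts ?G" for A
      using card_common_nbh_petersen[OF that that] that by (simp add: verts choose_two)
    show "open_nbh ?G A \<inter> open_nbh ?G B = {}" if "A \<in> open_nbh ?G B" for A B
    proof -
      have "A \<in> pverts ?G" "B \<in> pverts ?G" "A \<inter> B = {}"
        using that by (auto simp: open_nbh_def kneser_graph_def)
      then show ?thesis
        using card_common_nbh_petersen[of A B] by (simp add: binomial_eq_0)
    qed
    show "card (open_nbh ?G A \<inter> open_nbh ?G B) = 1"
      if AB: "A \<in> pverts ?G" "B \<in> pverts ?G" and "A \<noteq> B" "A \<notin> open_nbh ?G B" for A B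
    proof -
      have fin: "finite A" "finite B" and card: "card A = 2" "card B = 2"
        using AB by (auto simp: verts intro: finite_subset)
      have "A \<inter> B \<noteq> {}"
        using that by (auto simp: open_nbh_kneser_graph verts)
      then have "card (A \<inter> B) \<noteq> 0"
        using fin by simp
      moreover have "card (A \<inter> B) < 2"
      proof (rule ccontr)
        assume "\<not> card (A \<inter> B) < 2"
        then have "A \<inter> B = A" "A \<inter> B = B"
          using fin card card_seteq[of A "A \<inter> B"] card_seteq[of B "A \<inter> B"] by auto
        then show False using \<open>A \<noteq> B\<close> by simp
      qed
      ultimately have "card (A \<inter> B) = 1" by simp
      then show ?thesis
        using card_common_nbh_petersen[OF AB] by (simp add: choose_two)
    qed
  qed
qed

theorem theorem4p13:
  shows "fractional_eternal_domination_number (kneser_graph 5 2) = 3"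
  using moore_graph_diam2.fractional_eternal_domination_number_eq_degree[OF moore_graph_petersen]
  by simp

end
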